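(* Let $N$ be an odd perfect number (i.e. $N$ is odd and $\sigma(N)=2N$), and write $\omega=\omega(N)$ for the number of distinct prime factors of $N$ and $\Omega=\Omega(N)$ for the number of prime factors of $N$ counted with multiplicity. If $3\nmid N$, then $$\frac{302}{113}\omega-\frac{286}{113}\le \Omega.$$ If $3\mid N$, then $$\frac{66}{25}\omega-5\le \Omega.$$
   Context: $\sigma(n)$ denotes the sum of the positive divisors of $n$. *)

theory Defs
  imports Complex_Main "HOL-Number_Theory.Number_Theory"
begin

definition divisor_sigma :: "nat \<Rightarrow> nat" where
  "divisor_sigma n = (\<Sum>d | d dvd n. d)"

text \<open>
  Since \<open>0\<close> has infinitely many divisors, the sum above is \<open>0\<close> at \<open>n = 0\<close>, and
  so \<open>0\<close> has to be excluded explicitly here.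
\<close>
definition perfect :: "nat \<Rightarrow> bool" where
  "perfect n \<longleftrightarrow> n > 0 \<and> divisor_sigma n = 2 * n"

definition primes_omega :: "nat \<Rightarrow> nat" where
  "primes_omega n = card (prime_factors n)"

text \<open>\<open>prime_factorization\<close> is a multiset, so its size counts multiplicities.\<close>
definition primes_Omega :: "nat \<Rightarrow> nat" where
  "primes_Omega n = size (prime_factorization n)"

end

theory Submission
  imports Defs
begin

text \<open>
  Write \<open>\<Phi>(s) = s\<^sup>2 + s + 1\<close>. If \<open>s\<^sup>2\<close> exactly divides \<open>N\<close>, then \<open>\<Phi>(s)\<close> divides \<open>N\<close>, and
  apart from at most one factor \<open>3\<close> all its prime factors are \<open>1\<close> mod \<open>3\<close>. Many primes of
  exponent \<open>2\<close> therefore force many prime factors \<open>1\<close> mod \<open>3\<close>, counted with multiplicity, and those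
  with \<open>s \<equiv> 1\<close> (mod \<open>3\<close>) force a large power of \<open>3\<close>.
  The count is sharpened by two rigidity facts. First, if a prime \<open>r\<close> divides \<open>\<Phi>(x)\<close> and \<open>\<Phi>(y)\<close>
  with \<open>x, y < r\<close>, then \<open>x = y\<close> or \<open>x + y + 1 = r\<close>; together with parity and residues mod \<open>3\<close>
  this lets each prime \<open>r\<close> serve only once as the (larger) prime factor of a value \<open>\<Phi>(s)\<close> with few
  prime factors. Second, factoring in the Eisenstein integers shows that a product of three primes, each
  of the form \<open>\<Phi>(p)\<close>, is never of the form \<open>\<Phi>(s)\<close>.
  A prime of the form \<open>\<Phi>(s)\<close> then gets weight \<open>5\<close> and the other primes \<open>1\<close> mod \<open>3\<close> get weight
  \<open>7\<close>, plus a bonus \<open>5\<close>; comparing the total weight with the weights of the factors of the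
  \<open>\<Phi>(s)\<close> gives a linear inequality implying both bounds.
\<close>

section \<open>The values of the third cyclotomic polynomial\<close>

definition cyc3 :: "nat \<Rightarrow> nat" where
  "cyc3 n = n^2 + n + 1"

lemma int_cyc3: "int (cyc3 n) = (int n)^2 + int n + 1"
  by (simp add: cyc3_def)

lemma strict_mono_cyc3: "strict_mono cyc3"
  by (rule strict_monoI) (simp add: cyc3_def add_less_mono power_strict_mono)

lemma cyc3_eq_iff [simp]: "cyc3 m = cyc3 n \<longleftrightarrow> m = n"
  by (rule strict_mono_eq [OF strict_mono_cyc3])

lemma odd_cyc3 [simp]: "odd (cyc3 n)"
  by (simp add: cyc3_def)

lemma cyc3_mod: "cyc3 n mod m = cyc3 (n mod m) mod m"
proof -
  have "[cyc3 n = cyc3 (n mod m)] (mod m)"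
    unfolding cyc3_def by (intro cong_add cong_pow) auto
  then show ?thesis by (simp add: cong_def)
qed

lemma three_dvd_cyc3_iff: "3 dvd cyc3 n \<longleftrightarrow> n mod 3 = 1"
proof -
  have "n mod 3 < 3" by simp
  then consider "n mod 3 = 0" | "n mod 3 = 1" | "n mod 3 = 2" by linarith
  then show ?thesis
    unfolding dvd_eq_mod_eq_0 cyc3_mod[of n 3] by cases (simp_all add: cyc3_def)
qed

lemma not_9_dvd_cyc3: "\<not> 9 dvd cyc3 n"
proof
  assume 9: "9 dvd cyc3 n"
  then have "3 dvd cyc3 n" by (rule dvd_trans[rotated]) simp
  then have "n mod 3 = 1" by (simp add: three_dvd_cyc3_iff)
  then obtain t where "n = 3 * t + 1" by (metis mult_div_mod_eq)
  then have "cyc3 n = 9 * (t^2 + t) + 3" by (simp add: cyc3_def power2_eq_square algebra_simps)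
  then show False using 9 by presburger
qed

text \<open>If \<open>r\<close> were 2 mod 3, then n^3 = 1 and Fermat's n^(r-1) = 1 modulo
  \<open>r\<close>, with \<open>r - 1\<close> congruent to 1 mod 3, would force n = 1 modulo
  \<open>r\<close>. Then \<open>cyc3 n\<close> is 3 modulo \<open>r\<close>, so \<open>r\<close>
  divides 3.\<close>

lemma prime_dvd_cyc3:
  assumes "prime r" "r dvd cyc3 n"
  shows "r = 3 \<or> r mod 3 = 1"
proof (rule ccontr)
  assume neg: "\<not> ?thesis"
  have three: "prime (3::nat)" by simp
  have "r mod 3 \<noteq> 0"
    using neg assms(1) three by (metis dvd_eq_mod_eq_0 primes_dvd_imp_eq)
  then have "r mod 3 = 2" using neg by linarith
  then have k: "r - 1 = 3 * (r div 3) + 1" by presburger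
  have ndvd: "\<not> r dvd n"
  proof
    assume "r dvd n"
    then have "r dvd n^2 + n" by (simp add: power2_eq_square dvd_add)
    then have "r dvd 1" using assms(2) unfolding cyc3_def by (simp only: dvd_add_right_iff)
    then show False using assms(1) by auto
  qed
  have "int n ^ 3 - 1 = (int n - 1) * int (cyc3 n)"
    by (simp add: int_cyc3 algebra_simps power2_eq_square power3_eq_cube)
  then have "int r dvd int n ^ 3 - 1" using assms(2) by simp
  then have "[int (n ^ 3) = int 1] (mod int r)" by (simp add: cong_iff_dvd_diff)
  then have cube: "[n ^ 3 = 1] (mod r)" unfolding cong_int_iff .
  have "[n ^ (r - 1) = 1] (mod r)" using fermat_theorem assms(1) ndvd by blast
  moreover have "[n ^ (r - 1) = 1 ^ (r div 3) * n] (mod r)"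
    unfolding k power_add power_mult power_one_right
    by (intro cong_mult cong_pow cube cong_refl)
  ultimately have "[1 ^ (r div 3) * n = 1] (mod r)" using cong_sym cong_trans by blast
  then have n1: "[n = 1] (mod r)" by simp
  then have "[cyc3 n = 1^2 + 1 + 1] (mod r)" unfolding cyc3_def
    by (intro cong_add cong_pow) auto
  then have "[cyc3 n = 3] (mod r)" by (simp add: numeral_3_eq_3)
  then have "r dvd 3" using assms(2) cong_dvd_iff by blast
  then show False using neg assms(1) primes_dvd_imp_eq three by blast
qed

text \<open>The difference of the two values is (x - y)(x + y + 1), and the second factor stays
  below 2r.\<close>

lemma cyc3_roots:
  assumes "prime r" "r dvd cyc3 x" "r dvd cyc3 y" "x < r" "y < r"
  shows "x = y \<or> x + y + 1 = r"
proof -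
  have "int r dvd int (cyc3 x) - int (cyc3 y)" using assms(2,3) by simp
  also have "int (cyc3 x) - int (cyc3 y) = (int x - int y) * (int x + int y + 1)"
    by (simp add: int_cyc3 algebra_simps power2_eq_square)
  finally have "int r dvd int x - int y \<or> int r dvd int x + int y + 1"
    using assms(1) by (simp add: prime_dvd_mult_iff)
  then show ?thesis
  proof
    assume "int r dvd int x - int y"
    then have "int x = int y"
      using assms(4,5) dvd_imp_le_int[of "int x - int y" "int r"] by linarith
    then show ?thesis by simp
  next
    assume "int r dvd int x + int y + 1"
    then have "r dvd x + y + 1" by (metis of_nat_1 of_nat_add of_nat_dvd_iff)
    then obtain c where c: "x + y + 1 = r * c" by blast
    have "r * c < r * 2" using assms(4,5) c by linarith
    then have "c = 1" using c by (cases c) auto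
    then show ?thesis using c by simp
  qed
qed

lemma less_of_cyc3_less_square: "cyc3 x \<le> r^2 \<Longrightarrow> x < r"
  unfolding cyc3_def by (rule power_less_imp_less_base[of _ 2]) auto

text \<open>The second root \<open>r - 1 - s\<close> has the wrong residue: s + t + 1 is 2 mod 3,
  while \<open>r\<close> is 1 mod 3.\<close>

lemma cyc3_root_unique:
  assumes "prime r" "r mod 3 = 1" "r dvd cyc3 s" "r dvd cyc3 t" "s < r" "t < r"
    and "s mod 3 = 2" "t mod 3 = 2"
  shows "s = t"
  using cyc3_roots[OF assms(1,3-6)]
proof
  assume "s + t + 1 = r"
  moreover have "(s + t + 1) mod 3 = ((s mod 3 + t mod 3) mod 3 + 1) mod 3"
    by (metis mod_add_eq mod_add_left_eq)
  ultimately show ?thesis using assms(2,7,8) by simp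
qed

text \<open>The roots below the prime \<open>cyc3 t\<close> are \<open>t\<close> and
  \<open>t^2\<close>. Residues mod 3 leave \<open>P = t^2\<close>, whose value t^4 + t^2 + 1 is too
  large. Later \<open>P\<close> is either a prime or an even number \<open>p - 3\<close>.\<close>

lemma cyc3_neq_3_mult_cyc3:
  assumes "prime (cyc3 t)" "odd t" "t mod 3 = 2" "P mod 3 = 1"
  shows "cyc3 P \<noteq> 3 * cyc3 t"
proof
  assume eq: "cyc3 P = 3 * cyc3 t"
  have t: "t \<ge> 5" using assms(2,3) by presburger
  have t2: "5 * t \<le> t^2" using t by (simp add: power2_eq_square)
  have "3 \<le> cyc3 t" using t by (simp add: cyc3_def)
  then have "3 * cyc3 t \<le> (cyc3 t)^2" by (simp add: power2_eq_square)
  then have P: "P < cyc3 t" using less_of_cyc3_less_square eq by metis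
  have "t < cyc3 t" by (simp add: cyc3_def)
  then have "P = t \<or> P + t + 1 = cyc3 t"
    using cyc3_roots[OF assms(1) _ _ P] eq by simp
  then have "P = t^2" using assms(3,4) by (auto simp: cyc3_def)
  then have "t^2 * t^2 + t^2 + 1 = 3 * (t^2 + t + 1)"
    using eq by (simp add: cyc3_def power2_eq_square[of "t^2"])
  then have "t^2 * t^2 = 2 * t^2 + 3 * t + 2" by simp
  moreover have t25: "25 \<le> t^2" using t2 t by linarith
  then have "25 * t^2 \<le> t^2 * t^2" by (intro mult_right_mono) auto
  ultimately have "25 * t^2 \<le> 2 * t^2 + 3 * t + 2" by simp
  then show False using t2 t25 by linarith
qed

text \<open>Let \<open>q \<le> t\<close> by symmetry and F = \<open>cyc3 t\<close>. The candidates
  for \<open>p\<close> below 2F are t, t^2, F + t and F + t^2. The last two are even, p = t would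
  give 1 = 3 * \<open>cyc3 q\<close>, and t^2 is not prime.\<close>

lemma cyc3_neq_3_mult_cyc3_mult_cyc3:
  assumes "prime p" "odd p" "prime (cyc3 q)" "odd q" "q mod 3 = 2" "prime (cyc3 t)" "odd t" "t mod 3 = 2"
  shows "cyc3 p \<noteq> 3 * (cyc3 q * cyc3 t)"
proof -
  have *: False if "q \<le> t" and eq: "cyc3 p = 3 * (cyc3 q * cyc3 t)"
    and t: "prime (cyc3 t)" "odd t" "t mod 3 = 2" for q t
  proof -
    let ?F = "cyc3 t"
    have t1: "t \<noteq> 0" using t(3) by auto
    have "cyc3 q \<le> ?F" using strict_mono_cyc3 that(1) by (simp add: strict_mono_less_eq)
    then have "cyc3 p \<le> 3 * (?F * ?F)" using eq by simp
    also have "\<dots> \<le> (2 * ?F)^2" by (simp add: power2_eq_square)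
    finally have p: "p < 2 * ?F" by (rule less_of_cyc3_less_square)
    have tF: "t < ?F" by (simp add: cyc3_def)
    have pt: "p \<noteq> t"
    proof
      assume "p = t"
      then have "?F * 1 = ?F * (3 * cyc3 q)" using eq by (simp add: mult_ac)
      then have "1 = 3 * cyc3 q" using tF by (simp only: mult_cancel_left) auto
      then show False by simp
    qed
    have par: "odd p" "odd t" "odd ?F" using assms(2) t by auto
    have "p = t^2"
    proof (cases "p < ?F")
      case True
      then have "p = t \<or> p + t + 1 = ?F"
        using cyc3_roots[OF t(1) _ _ True tF] eq by simp
      then show ?thesis using pt by (auto simp: cyc3_def)
    next
      case False
      define y where "y = p - ?F"
      have py: "p = y + ?F" using False by (simp add: y_def)
      have yF: "y < ?F" using p py by simp
      have "cyc3 p = cyc3 y + ?F * (2 * y + ?F + 1)"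
        unfolding py by (simp add: cyc3_def[of "y + _"] cyc3_def[of y] algebra_simps power2_eq_square)
      moreover have "?F dvd cyc3 p" using eq by simp
      ultimately have "?F dvd cyc3 y" by (metis dvd_add_left_iff dvd_triv_left)
      then have "y = t \<or> y + t + 1 = ?F"
        using cyc3_roots[OF t(1) _ _ yF tF] by simp
      moreover have "even y" using par py by simp
      ultimately show ?thesis using par by presburger
    qed
    then show False using assms(1) prime_power_iff[of t 2] by (auto simp: prime_power_iff)
  qed
  show ?thesis
  proof (cases "q \<le> t")
    case True
    then show ?thesis using *[OF True _ assms(6-8)] by blast
  next
    case False
    then show ?thesis using *[of t q, OF _ _ assms(3-5)] by (auto simp: mult.commute[of "cyc3 q"])
  qed
qed

text \<open>Since \<open>p\<close> and \<open>s\<close> differ mod 3, they are the two roots modulo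
  \<open>r\<close>, so s = r - 1 - p. Substituting gives r' = r - 2p + 2, which turns cyc3 p - 6p +
  6, the value at \<open>p - 3\<close>, into 3r'.\<close>

lemma cyc3_coincidence:
  assumes "prime r" "r mod 3 = 1" "p mod 3 = 1" "s mod 3 = 2" "cyc3 p = 3 * r" "cyc3 s = r * r'" "r' < r"
  shows "3 \<le> p" "cyc3 (p - 3) = 3 * r'"
proof -
  have "r \<ge> 3" using assms(1,2) prime_ge_2_nat[of r] by presburger
  then have "cyc3 p \<le> r^2" using assms(5) by (simp add: power2_eq_square)
  then have p: "p < r" by (rule less_of_cyc3_less_square)
  have "cyc3 s \<le> r^2" using assms(6,7) by (simp add: power2_eq_square)
  then have s: "s < r" by (rule less_of_cyc3_less_square)
  have "p = s \<or> p + s + 1 = r" using cyc3_roots[OF assms(1) _ _ p s] assms(5,6) by simp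
  then have sum: "p + s + 1 = r" using assms(3,4) by auto
  have "p \<noteq> 1" using assms(5) \<open>r \<ge> 3\<close> by (auto simp: cyc3_def)
  then show p3: "3 \<le> p" using assms(3) by presburger
  have sr: "int s = int r - 1 - int p" using sum by linarith
  have ep: "(int p)^2 + int p + 1 = 3 * int r" using assms(5) int_cyc3[of p] by simp
  have "int r * int r' = (int r - 1 - int p)^2 + (int r - 1 - int p) + 1"
    using assms(6) int_cyc3[of s] sr by simp
  also have "\<dots> = int r * int r - 2 * int r * int p - int r + ((int p)^2 + int p + 1)"
    by (simp add: algebra_simps power2_eq_square)
  also have "\<dots> = int r * (int r - 2 * int p + 2)" unfolding ep by (simp add: algebra_simps)
  finally have r': "int r' = int r - 2 * int p + 2" using \<open>r \<ge> 3\<close> by simp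
  have "int (cyc3 (p - 3)) = (int p)^2 + int p + 1 - 6 * int p + 6"
    unfolding int_cyc3 using p3 by (simp add: of_nat_diff algebra_simps power2_eq_square)
  also have "\<dots> = int (3 * r')" unfolding ep using r' by simp
  finally show "cyc3 (p - 3) = 3 * r'" by linarith
qed

section \<open>Products of three prime values\<close>

text \<open>
  The pair \<open>(a, b)\<close> stands for the Eisenstein integer \<open>a + b\<omega>\<close>, of norm \<open>a\<^sup>2 - a b + b\<^sup>2\<close>.
  The norm of \<open>p - \<omega>\<close> is \<open>cyc3 p\<close>, and \<open>-1 - p - \<omega>\<close> is minus its conjugate.
\<close>

lemma eisenstein_divide:
  fixes a b :: int and p :: nat
  assumes "prime (cyc3 p)" "int (cyc3 p) dvd a^2 - a*b + b^2"
  obtains x c d where "x = int p \<or> x = - 1 - int p"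
    "a = x * c + d" "b = x * d - c + d"
    "a^2 - a*b + b^2 = int (cyc3 p) * (c^2 - c*d + d^2)"
proof -
  let ?R = "int (cyc3 p)"
  \<comment> \<open>Modulo \<open>cyc3 p\<close> the norm splits into two linear forms, one for each
    choice of \<open>x\<close>; primality selects one.\<close>
  have "(a + b * int p) * (a + b * (- 1 - int p)) = a^2 - a*b + b^2 - b^2 * ?R"
    by (simp add: int_cyc3 algebra_simps power2_eq_square)
  then have "?R dvd (a + b * int p) * (a + b * (- 1 - int p))" using assms(2) by simp
  then have "?R dvd a + b * int p \<or> ?R dvd a + b * (- 1 - int p)"
    using assms(1) by (simp add: prime_dvd_mult_iff)
  then obtain x where x: "x = int p \<or> x = - 1 - int p" "?R dvd a + b * x" by blast
  have R: "?R = x^2 + x + 1" using x(1)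
    by (elim disjE; simp only:; simp add: int_cyc3 algebra_simps power2_eq_square)
  obtain d where d: "a + b * x = ?R * d" using x(2) by blast
  \<comment> \<open>The pair \<open>(c, d)\<close> is the quotient of a + b\<omega> by x -
    \<omega>.\<close>
  define c where "c = (x + 1) * d - b"
  have b: "b = x * d - c + d" by (simp add: c_def algebra_simps)
  have a: "a = x * c + d"
    using d unfolding R c_def by (simp add: algebra_simps power2_eq_square)
  have "a^2 - a*b + b^2 = ?R * (c^2 - c*d + d^2)"
    unfolding R a b by (simp add: algebra_simps power2_eq_square)
  then show ?thesis using that x(1) a b by blast
qed

text \<open>These are the six units. Completing the square in either variable bounds both
  coordinates by 1.\<close>

lemma eisenstein_norm_1:
  fixes c d :: int
  assumes "c^2 - c*d + d^2 = 1"
  shows "(c, d) \<in> {(1,0), (-1,0), (0,1), (0,-1), (1,1), (-1,-1)}"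
proof -
  have e1: "(2 * c - d)^2 + 3 * d^2 = 4" and e2: "(2 * d - c)^2 + 3 * c^2 = 4"
    using assms by (simp_all add: algebra_simps power2_eq_square)
  have "d^2 \<le> 1" "c^2 \<le> 1"
    using e1 e2 zero_le_power2[of "2*c-d"] zero_le_power2[of "2*d-c"] by linarith+
  then have "\<bar>d\<bar> \<le> 1" "\<bar>c\<bar> \<le> 1" by (simp_all add: abs_square_le_1)
  then have "c \<in> {-1,0,1}" "d \<in> {-1,0,1}" by auto
  then show ?thesis using assms by auto
qed

text \<open>Dividing s - \<omega> in turn by x - \<omega>, y - \<omega> and z - \<omega> leaves a
  unit u, and a + b\<omega> is the product of the three divisors. The \<omega>-coordinate of (a +
  b\<omega>)u is -1; depending on u it is, up to sign, \<open>a\<close>, \<open>b\<close> or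
  \<open>a - b\<close>.\<close>

lemma eisenstein_triple:
  fixes s p q r :: nat
  assumes "prime (cyc3 p)" "prime (cyc3 q)" "prime (cyc3 r)"
    and "cyc3 s = cyc3 p * (cyc3 q * cyc3 r)"
  obtains x y z a b :: int where
    "x = int p \<or> x = - 1 - int p" "y = int q \<or> y = - 1 - int q" "z = int r \<or> z = - 1 - int r"
    "a = x * y * z - 1 - (x + y + z)" "b = - (x * y + x * z + y * z + x + y + z)"
    "\<bar>a\<bar> = 1 \<or> \<bar>b\<bar> = 1 \<or> \<bar>a - b\<bar> = 1"
proof -
  have N: "(int s)^2 - int s * (-1) + (-1)^2 = int (cyc3 s)"
    by (simp add: int_cyc3)
  have pos: "int (cyc3 n) \<noteq> 0" for n
    by (metis even_zero odd_cyc3 of_nat_eq_0_iff)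
  obtain x c d where 1: "x = int p \<or> x = - 1 - int p"
    "int s = x * c + d" "-1 = x * d - c + d"
    "int (cyc3 s) = int (cyc3 p) * (c^2 - c*d + d^2)"
    using eisenstein_divide[OF assms(1), of "int s" "-1"] unfolding N assms(4) by auto
  have n1: "c^2 - c*d + d^2 = int (cyc3 q) * int (cyc3 r)"
    using 1(4) pos[of p] unfolding assms(4) by simp
  obtain y c' d' where 2: "y = int q \<or> y = - 1 - int q"
    "c = y * c' + d'" "d = y * d' - c' + d'"
    "c^2 - c*d + d^2 = int (cyc3 q) * (c'^2 - c'*d' + d'^2)"
    using eisenstein_divide[OF assms(2), of c d] unfolding n1 by auto
  have n2: "c'^2 - c'*d' + d'^2 = int (cyc3 r)"
    using 2(4) n1 pos[of q] by simp
  obtain z c'' d'' where 3: "z = int r \<or> z = - 1 - int r"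
    "c' = z * c'' + d''" "d' = z * d'' - c'' + d''"
    "c'^2 - c'*d' + d'^2 = int (cyc3 r) * (c''^2 - c''*d'' + d''^2)"
    using eisenstein_divide[OF assms(3), of c' d'] unfolding n2 by auto
  have n3: "c''^2 - c''*d'' + d''^2 = 1"
    using 3(4) n2 pos[of r] by simp
  define a b where ab: "a = x * y * z - 1 - (x + y + z)" "b = - (x * y + x * z + y * z + x + y + z)"
  have "-1 = a * d'' + b * c'' - b * d''"
    unfolding 1(3) 2(2,3) 3(2,3) ab by (simp add: algebra_simps)
  then have "\<bar>a\<bar> = 1 \<or> \<bar>b\<bar> = 1 \<or> \<bar>a - b\<bar> = 1"
    using eisenstein_norm_1[OF n3] by auto
  then show ?thesis using that 1(1) 2(1) 3(1) ab by blast
qed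

text \<open>The value 1 means r(p + q + 1) = pq, so \<open>r\<close> is \<open>p\<close> or
  \<open>q\<close>, and cancelling it is absurd. The value -1 means r(p + q + 1) + 2 = pq, which
  reads 0 = 1 mod 3.\<close>

lemma mixed_signs_impossible:
  fixes p q r :: nat
  assumes "prime p" "prime q" "prime r" "p mod 3 = 2" "q mod 3 = 2" "r mod 3 = 2"
  shows "\<bar>int r * (int p + int q + 1) + 1 - int p * int q\<bar> \<noteq> 1"
proof
  assume "\<bar>int r * (int p + int q + 1) + 1 - int p * int q\<bar> = 1"
  then consider "int r * (int p + int q + 1) = int p * int q"
    | "int r * (int p + int q + 1) + 2 = int p * int q" by linarith
  then show False
  proof cases
    case 1
    then have eq: "r * (p + q + 1) = p * q"
      unfolding of_nat_eq_iff[where 'a = int, symmetric] by (simp add: algebra_simps)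
    then have "r dvd p * q" by (metis dvd_triv_left)
    then have "r = p \<or> r = q"
      using assms(1-3) primes_dvd_imp_eq by (auto simp: prime_dvd_mult_iff)
    then show False
    proof
      assume "r = p"
      then have "p * (p + q + 1) = p * q" using eq by simp
      then have "p + q + 1 = q" using assms(1) by (metis mult_cancel_left not_prime_0)
      then show False by simp
    next
      assume "r = q"
      then have "q * (p + q + 1) = q * p" using eq by (simp add: mult.commute)
      then have "p + q + 1 = p" using assms(2) by (metis mult_cancel_left not_prime_0)
      then show False by simp
    qed
  next
    case 2
    then have eq: "r * (p + q + 1) + 2 = p * q"
      unfolding of_nat_eq_iff[where 'a = int, symmetric] by (simp add: algebra_simps)
    have c: "[p = 2] (mod 3)" "[q = 2] (mod 3)" "[r = 2] (mod 3)"
      using assms(4-6) by (simp_all add: cong_def)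
    have "[r * (p + q + 1) + 2 = 2 * (2 + 2 + 1) + 2] (mod 3)"
      by (intro cong_add cong_mult c cong_refl)
    moreover have "[p * q = 2 * 2] (mod 3)"
      by (intro cong_mult c)
    ultimately show False using eq by (simp add: cong_def)
  qed
qed

text \<open>If x, y, z all have the same sign, then \<open>a\<close>, \<open>b\<close> and
  \<open>a - b\<close> are all too large in absolute value. For mixed signs only \<open>b\<close>
  can be small, and it is the form excluded by \<open>mixed_signs_impossible\<close>, with the
  variable of deviating sign in the role of \<open>r\<close>.\<close>

lemma cyc3_neq_triple_product:
  assumes "prime p" "prime q" "prime r" "odd p" "odd q" "odd r"
    and "p mod 3 = 2" "q mod 3 = 2" "r mod 3 = 2"
    and "prime (cyc3 p)" "prime (cyc3 q)" "prime (cyc3 r)"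
  shows "cyc3 s \<noteq> cyc3 p * (cyc3 q * cyc3 r)"
proof
  assume "cyc3 s = cyc3 p * (cyc3 q * cyc3 r)"
  then obtain x y z a b :: int where *:
    "x = int p \<or> x = - 1 - int p" "y = int q \<or> y = - 1 - int q" "z = int r \<or> z = - 1 - int r"
    "a = x * y * z - 1 - (x + y + z)" "b = - (x * y + x * z + y * z + x + y + z)"
    "\<bar>a\<bar> = 1 \<or> \<bar>b\<bar> = 1 \<or> \<bar>a - b\<bar> = 1"
    by (rule eisenstein_triple[OF assms(10-12)])
  define P Q R where PQR: "P = int p" "Q = int q" "R = int r"
  have five: "int n \<ge> 5" if "odd n" "n mod 3 = 2" for n using that by presburger
  have ge: "P \<ge> 5" "Q \<ge> 5" "R \<ge> 5"
    unfolding PQR using assms(4-9) five by auto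
  have pq: "P * Q \<ge> 5 * P" "P * Q \<ge> 5 * Q" "P * R \<ge> 5 * P" "P * R \<ge> 5 * R" "Q * R \<ge> 5 * Q" "Q * R \<ge> 5 * R"
    using ge by (auto intro: mult_mono simp: mult.commute[of 5])
  have pqr: "P * Q * R \<ge> 5 * (P * Q)" "P * Q * R \<ge> 5 * (P * R)" "P * Q * R \<ge> 5 * (Q * R)"
    using ge pq by (auto intro: mult_mono simp: mult_ac)
  have m1: "\<bar>R * (P + Q + 1) + 1 - P * Q\<bar> \<noteq> 1"
    unfolding PQR by (rule mixed_signs_impossible) (use assms in auto)
  have m2: "\<bar>Q * (P + R + 1) + 1 - P * R\<bar> \<noteq> 1"
    unfolding PQR by (rule mixed_signs_impossible) (use assms in auto)
  have m3: "\<bar>P * (Q + R + 1) + 1 - Q * R\<bar> \<noteq> 1"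
    unfolding PQR by (rule mixed_signs_impossible) (use assms in auto)
  have xyz: "x = P \<or> x = - 1 - P" "y = Q \<or> y = - 1 - Q" "z = R \<or> z = - 1 - R"
    using *(1-3) unfolding PQR by auto
  note abs = *(6)[unfolded *(4,5)]
  show False
    using xyz(1)
  proof
    assume x: "x = P"
    show False using xyz(2)
    proof
      assume y: "y = Q"
      show False using xyz(3)
      proof
        assume z: "z = R"
        show False using abs ge pq pqr unfolding x y z by (simp add: algebra_simps)
      next
        assume z: "z = - 1 - R"
        show False using abs ge pq pqr m1 unfolding x y z by (simp add: algebra_simps)
      qed
    next
      assume y: "y = - 1 - Q"
      show False using xyz(3)
      proof
        assume z: "z = R"
        show False using abs ge pq pqr m2 unfolding x y z by (simp add: algebra_simps)
      next
        assume z: "z = - 1 - R"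
        show False using abs ge pq pqr m3 unfolding x y z by (simp add: algebra_simps)
      qed
    qed
  next
    assume x: "x = - 1 - P"
    show False using xyz(2)
    proof
      assume y: "y = Q"
      show False using xyz(3)
      proof
        assume z: "z = R"
        show False using abs ge pq pqr m3 unfolding x y z by (simp add: algebra_simps)
      next
        assume z: "z = - 1 - R"
        show False using abs ge pq pqr m2 unfolding x y z by (simp add: algebra_simps)
      qed
    next
      assume y: "y = - 1 - Q"
      show False using xyz(3)
      proof
        assume z: "z = R"
        show False using abs ge pq pqr m1 unfolding x y z by (simp add: algebra_simps)
      next
        assume z: "z = - 1 - R"
        show False using abs ge pq pqr unfolding x y z by (simp add: algebra_simps)
      qed
    qed
  qed
qed

section \<open>The divisor sum\<close>

lemma divisor_sigma_prime_power_mult: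
  assumes "prime p" "\<not> p dvd n"
  shows "divisor_sigma (p ^ k * n) = (\<Sum>i\<le>k. p ^ i) * divisor_sigma n"
proof -
  let ?h = "\<lambda>(i, d). p ^ i * d"
  \<comment> \<open>The multiplicity of \<open>p\<close> recovers \<open>i\<close>, which makes the
    parametrisation of the divisors injective.\<close>
  have mult: "multiplicity p (p ^ i * d) = i" if "d dvd n" for i d
  proof -
    have "\<not> p dvd d" using that assms(2) dvd_trans by blast
    then show ?thesis using assms(1)
      by (intro multiplicity_eqI) (auto simp: mult.commute[of p])
  qed
  have inj: "inj_on ?h ({..k} \<times> {d. d dvd n})"
  proof (rule inj_onI, clarify)
    fix i d j d' assume "d dvd n" "d' dvd n" and eq: "p ^ i * d = p ^ j * d'"
    then have "i = j" using mult by metis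
    then show "i = j \<and> d = d'" using eq assms(1) by auto
  qed
  have "{d. d dvd p ^ k * n} = ?h ` ({..k} \<times> {d. d dvd n})"
  proof (rule Set.set_eqI, rule iffI)
    fix x assume "x \<in> {d. d dvd p ^ k * n}"
    then obtain b d where bd: "x = b * d" "b dvd p ^ k" "d dvd n"
      using division_decomp by blast
    then obtain i where "i \<le> k" "b = p ^ i" using divides_primepow_nat[OF assms(1)] by blast
    then show "x \<in> ?h ` ({..k} \<times> {d. d dvd n})" using bd by auto
  next
    fix x assume "x \<in> ?h ` ({..k} \<times> {d. d dvd n})"
    then show "x \<in> {d. d dvd p ^ k * n}" by (auto intro!: mult_dvd_mono le_imp_power_dvd)
  qed
  then have "divisor_sigma (p ^ k * n) = (\<Sum>d\<in>?h ` ({..k} \<times> {d. d dvd n}). d)"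
    by (simp only: divisor_sigma_def)
  also have "\<dots> = (\<Sum>(i, d)\<in>{..k} \<times> {d. d dvd n}. p ^ i * d)"
    by (subst sum.reindex[OF inj]) simp
  finally show ?thesis
    unfolding divisor_sigma_def by (simp add: sum_product sum.cartesian_product)
qed

lemma divisor_sigma_prod_prime_powers:
  assumes "finite A" "\<And>p. p \<in> A \<Longrightarrow> prime p"
  shows "divisor_sigma (\<Prod>p\<in>A. p ^ e p) = (\<Prod>p\<in>A. \<Sum>i\<le>e p. p ^ i)"
  using assms
proof (induction A rule: finite_induct)
  case empty
  then show ?case by (simp add: divisor_sigma_def)
next
  case (insert p A)
  have "\<not> p dvd (\<Prod>q\<in>A. q ^ e q)"
  proof
    assume "p dvd (\<Prod>q\<in>A. q ^ e q)"
    then obtain q where "q \<in> A" "p dvd q ^ e q"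
      using insert by (auto simp: prime_dvd_prod_iff)
    then show False
      using insert prime_dvd_power primes_dvd_imp_eq by (metis insertCI)
  qed
  then show ?case
    using insert by (simp add: divisor_sigma_prime_power_mult)
qed

lemma divisor_sigma_conv_prime_factors:
  assumes "n > 0"
  shows "divisor_sigma n = (\<Prod>p\<in>prime_factors n. \<Sum>i\<le>multiplicity p n. p ^ i)"
proof -
  have "divisor_sigma n = divisor_sigma (\<Prod>p\<in>prime_factors n. p ^ multiplicity p n)"
    using assms by (simp add: prime_factorization_nat[symmetric])
  also have "\<dots> = (\<Prod>p\<in>prime_factors n. \<Sum>i\<le>multiplicity p n. p ^ i)"
    by (rule divisor_sigma_prod_prime_powers) auto
  finally show ?thesis .
qed

lemma even_sum_powers_iff:
  fixes p :: nat
  assumes "odd p"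
  shows "even (\<Sum>i\<le>k. p ^ i) \<longleftrightarrow> odd k"
  using assms by (induction k) auto

section \<open>Exponents of an odd perfect number\<close>

locale odd_perfect =
  fixes N :: nat
  assumes odd_N: "odd N" and perfect_N: "perfect N"
begin

abbreviation "e p \<equiv> multiplicity p N"

abbreviation "P \<equiv> prime_factors N"

lemma N_pos: "N > 0" and sigma_N: "(\<Prod>p\<in>P. \<Sum>i\<le>e p. p ^ i) = 2 * N"
  using perfect_N divisor_sigma_conv_prime_factors by (auto simp: perfect_def)

lemma odd_prime_factor: "p \<in> P \<Longrightarrow> odd p"
  using odd_N by (meson dvd_trans in_prime_factors_imp_dvd)

text \<open>Every odd exponent contributes an even factor to \<sigma>(N) = 2N, and 2N is not
  divisible by 4.\<close>

lemma odd_exponent_unique: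
  assumes "p \<in> P" "q \<in> P" "odd (e p)" "odd (e q)"
  shows "p = q"
proof (rule ccontr)
  assume "p \<noteq> q"
  have "2 * 2 dvd (\<Sum>i\<le>e p. p ^ i) * (\<Sum>i\<le>e q. q ^ i)"
    using assms odd_prime_factor by (intro mult_dvd_mono) (simp_all add: even_sum_powers_iff)
  also have "\<dots> = (\<Prod>p\<in>{p, q}. \<Sum>i\<le>e p. p ^ i)" using \<open>p \<noteq> q\<close> by simp
  also have "\<dots> dvd (\<Prod>p\<in>P. \<Sum>i\<le>e p. p ^ i)"
    using assms by (intro prod_dvd_prod_subset) auto
  finally show False using odd_N by (simp add: sigma_N)
qed

lemma exponent_cases:
  assumes "p \<in> P"
  shows "e p = 2 \<or> 4 \<le> e p \<or> odd (e p)"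
proof -
  have "e p \<noteq> 0" using assms by (auto simp: prime_factors_multiplicity)
  then show ?thesis by presburger
qed

lemma prod_cyc3_dvd:
  assumes "S \<subseteq> P" "\<And>s. s \<in> S \<Longrightarrow> e s = 2"
  shows "(\<Prod>s\<in>S. cyc3 s) dvd N"
proof -
  have "(\<Prod>s\<in>S. cyc3 s) = (\<Prod>s\<in>S. \<Sum>i\<le>e s. s ^ i)"
    using assms(2) by (intro prod.cong) (auto simp: cyc3_def numeral_2_eq_2)
  also have "\<dots> dvd (\<Prod>p\<in>P. \<Sum>i\<le>e p. p ^ i)"
    using assms(1) by (intro prod_dvd_prod_subset) auto
  also have "\<dots> = 2 * N" by (rule sigma_N)
  finally have dvd: "(\<Prod>s\<in>S. cyc3 s) dvd 2 * N" .
  have "odd (\<Prod>s\<in>S. cyc3 s)" using finite_subset[OF assms(1)] by (simp add: even_prod_iff)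
  then have "coprime (\<Prod>s\<in>S. cyc3 s) 2" by simp
  then show ?thesis using dvd by (simp add: coprime_dvd_mult_right_iff)
qed

end

section \<open>Factors contributed by primes of exponent two\<close>

lemma sum_mset_conv_sum_count:
  fixes f :: "'a \<Rightarrow> nat"
  assumes "finite X" "set_mset M \<subseteq> X"
  shows "(\<Sum>x\<in>#M. f x) = (\<Sum>x\<in>X. count M x * f x)"
  using assms(2)
proof (induction M)
  case empty
  then show ?case by simp
next
  case (add a M)
  have "(\<Sum>x\<in>X. count (add_mset a M) x * f x) = (\<Sum>x\<in>X. count M x * f x + (if x = a then f x else 0))"
    by (intro sum.cong) auto
  also have "\<dots> = (\<Sum>x\<in>X. count M x * f x) + f a"
    using assms(1) add.prems by (simp add: sum.distrib)
  finally show ?case using add by simp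
qed

context odd_perfect
begin

definition "V = {p \<in> P. p mod 3 = 1}"

definition "D1 = {p \<in> P. e p = 2 \<and> p mod 3 = 1}"

definition "D2 = {p \<in> P. e p = 2 \<and> p mod 3 = 2}"

text \<open>Removing the only possible factor 3 leaves, for \<open>s\<close> in \<open>D1\<close> or
  \<open>D2\<close>, a number whose prime factors all lie in \<open>V\<close>.\<close>

definition "core s = (if s mod 3 = 1 then cyc3 s div 3 else cyc3 s)"

definition "A = cyc3 ` {s \<in> D2. prime (cyc3 s)}"

definition "B = V - A"

text \<open>The weights and the bonus 5 are balanced. For \<open>D2\<close>, two factors with bonus
  give at least 5 + 7 + 5 and three factors at least 5 + 5 + 7, both 17. For \<open>D1\<close>, one
  factor with bonus gives 7 + 5 and two factors at least 5 + 7, both 12.\<close>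

definition "weight r = (if r \<in> A then 5 else 7 :: nat)"

abbreviation "M s \<equiv> prime_factorization (core s)"

definition "W s = (\<Sum>r\<in>#M s. weight r)"

lemma D1_D: "s \<in> D1 \<Longrightarrow> prime s \<and> odd s \<and> s mod 3 = 1 \<and> cyc3 s = 3 * core s"
  using odd_prime_factor three_dvd_cyc3_iff[of s] by (auto simp: D1_def core_def)

lemma D2_D: "s \<in> D2 \<Longrightarrow> prime s \<and> odd s \<and> s mod 3 = 2 \<and> cyc3 s = core s"
  using odd_prime_factor by (auto simp: D2_def core_def)

lemma finite_sets [simp]: "finite V" "finite D1" "finite D2" "finite A" "finite B"
  by (auto simp: V_def D1_def D2_def A_def B_def)

lemma D_disjoint: "D1 \<inter> D2 = {}" "D2 \<inter> V = {}"
  by (auto simp: D1_def D2_def V_def)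

text \<open>Keeping the powers of 3 apart from the cores yields both \<open>card_D1_le\<close> and
  \<open>prod_core_dvd\<close>.\<close>

lemma core_dvd: "3 ^ card D1 * (\<Prod>s\<in>D1 \<union> D2. core s) dvd N"
proof -
  have "(\<Prod>s\<in>D1 \<union> D2. cyc3 s) = (\<Prod>s\<in>D1. cyc3 s) * (\<Prod>s\<in>D2. cyc3 s)"
    using D_disjoint by (simp add: prod.union_disjoint)
  also have "(\<Prod>s\<in>D1. cyc3 s) = (\<Prod>s\<in>D1. 3 * core s)"
    using D1_D by (intro prod.cong refl) blast
  also have "(\<Prod>s\<in>D2. cyc3 s) = (\<Prod>s\<in>D2. core s)"
    using D2_D by (intro prod.cong refl) blast
  also have "(\<Prod>s\<in>D1. 3 * core s) * (\<Prod>s\<in>D2. core s) = 3 ^ card D1 * (\<Prod>s\<in>D1 \<union> D2. core s)"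
    using D_disjoint by (simp add: prod.union_disjoint prod.distrib)
  finally have eq: "(\<Prod>s\<in>D1 \<union> D2. cyc3 s) = 3 ^ card D1 * (\<Prod>s\<in>D1 \<union> D2. core s)" .
  show ?thesis
    unfolding eq[symmetric] by (rule prod_cyc3_dvd) (auto simp: D1_def D2_def)
qed

lemma card_D1_le: "card D1 \<le> e 3"
  using core_dvd by (intro multiplicity_geI) (auto dest: dvd_mult_left simp: N_pos)

lemma core_nonzero: "core s \<noteq> 0"
proof -
  have "cyc3 s \<noteq> 0" by (metis odd_cyc3 even_zero)
  then show ?thesis using three_dvd_cyc3_iff[of s] by (auto simp: core_def)
qed

lemma prod_core_dvd: "(\<Prod>s\<in>D1 \<union> D2. core s) dvd N"
  using core_dvd by (rule dvd_mult_right)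

lemma prime_factor_core:
  assumes "s \<in> D1 \<union> D2" "r \<in># M s"
  shows "r \<in> V"
proof -
  have r: "prime r" "r dvd core s" using assms(2) by auto
  have "core s dvd cyc3 s" using assms(1) D1_D D2_D by (metis UnE dvd_refl dvd_triv_right)
  then have "r dvd cyc3 s" using r(2) dvd_trans by blast
  then have mod: "r = 3 \<or> r mod 3 = 1" using r(1) prime_dvd_cyc3 by blast
  have "\<not> 3 dvd core s"
  proof
    assume 3: "3 dvd core s"
    show False
    proof (cases "s \<in> D1")
      case True
      then have "3 * 3 dvd cyc3 s" using D1_D 3 by (metis dvd_refl mult_dvd_mono)
      then show False using not_9_dvd_cyc3 by simp
    next
      case False
      then have "s mod 3 = 2" "cyc3 s = core s" using assms(1) D2_D by auto
      then show False using 3 three_dvd_cyc3_iff[of s] by simp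
    qed
  qed
  then have "r mod 3 = 1" using mod r(2) by auto
  moreover have "core s dvd N"
    using assms(1) by (intro dvd_trans[OF _ prod_core_dvd] dvd_prodI) auto
  then have "r dvd N" using r(2) dvd_trans by blast
  ultimately show ?thesis using r(1) N_pos by (auto simp: V_def prime_factors_dvd)
qed

lemma A_subset_V: "A \<subseteq> V"
proof
  fix r assume "r \<in> A"
  then obtain s where s: "s \<in> D2" "prime (cyc3 s)" "r = cyc3 s" by (auto simp: A_def)
  then have "r \<in># M s" using D2_D by (simp add: prime_factorization_prime)
  then show "r \<in> V" using prime_factor_core s(1) by blast
qed

text \<open>Double counting: a prime \<open>r\<close> in \<open>V\<close> occurs at most
  \<open>e r\<close> times in all the cores together, because their product divides
  \<open>N\<close>.\<close>

lemma sum_W_le: "(\<Sum>s\<in>D1 \<union> D2. W s) \<le> 5 * (\<Sum>r\<in>A. e r) + 7 * (\<Sum>r\<in>B. e r)"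
proof -
  have mult: "(\<Sum>s\<in>D1 \<union> D2. count (M s) r) \<le> e r" if "r \<in> V" for r
  proof -
    have r: "prime r" using that by (auto simp: V_def)
    have "(\<Sum>s\<in>D1 \<union> D2. count (M s) r) = multiplicity r (\<Prod>s\<in>D1 \<union> D2. core s)"
      using r core_nonzero
      by (subst prime_elem_multiplicity_prod_distrib) (auto simp: count_prime_factorization_prime image_iff)
    also have "\<dots> \<le> e r"
      using prod_core_dvd N_pos by (intro dvd_imp_multiplicity_le) auto
    finally show ?thesis .
  qed
  have "(\<Sum>s\<in>D1 \<union> D2. W s) = (\<Sum>s\<in>D1 \<union> D2. \<Sum>r\<in>V. count (M s) r * weight r)"
    unfolding W_def using prime_factor_core
    by (intro sum.cong refl sum_mset_conv_sum_count) auto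
  also have "\<dots> = (\<Sum>r\<in>V. (\<Sum>s\<in>D1 \<union> D2. count (M s) r) * weight r)"
    by (subst sum.swap) (simp add: sum_distrib_right)
  also have "\<dots> \<le> (\<Sum>r\<in>V. e r * weight r)"
    using mult by (intro sum_mono mult_right_mono) auto
  also have "V = A \<union> B" using A_subset_V by (auto simp: B_def)
  also have "(\<Sum>r\<in>A \<union> B. e r * weight r) = (\<Sum>r\<in>A. e r * weight r) + (\<Sum>r\<in>B. e r * weight r)"
    by (rule sum.union_disjoint) (auto simp: B_def)
  also have "(\<Sum>r\<in>A. e r * weight r) = 5 * (\<Sum>r\<in>A. e r)"
    by (simp add: weight_def sum_distrib_left mult.commute)
  also have "(\<Sum>r\<in>B. e r * weight r) = 7 * (\<Sum>r\<in>B. e r)"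
    by (auto simp: weight_def sum_distrib_left mult.commute B_def intro!: sum.cong)
  finally show ?thesis .
qed

end

section \<open>Weights and slots\<close>

lemma size_2_multisetE:
  assumes "size K = 2"
  obtains a b where "K = {#a, b#}"
proof -
  obtain a L where L: "K = add_mset a L" "size L = 1"
    using assms size_eq_Suc_imp_eq_union[of K 1] by (auto simp: numeral_2_eq_2)
  then obtain b where "L = {#b#}" using size_1_singleton_mset by blast
  then show ?thesis using that L by blast
qed

lemma size_3_multisetE:
  assumes "size K = 3"
  obtains a b c where "K = {#a, b, c#}"
proof -
  obtain a L where L: "K = add_mset a L" "size L = 2"
    using assms size_eq_Suc_imp_eq_union[of K 2] by auto
  then obtain b c where "L = {#b, c#}" using size_2_multisetE by blast
  then show ?thesis using that L by blast
qed

context odd_perfect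
begin

text \<open>The elements of \<open>E\<close> and \<open>M1\<close> have too few factors to be sure
  of reaching 17 and 12. They receive the bonus, which is paid for by distinct slots in
  \<open>B\<close>.\<close>

definition "E = {s \<in> D2. size (M s) = 2}"

definition "M1 = {p \<in> D1. size (M p) = 1}"

definition "hi s = Max (prime_factors (core s))"

definition "lo s = Min (prime_factors (core s))"

text \<open>
  The injection \<open>slot\<close> sends an element of \<open>E\<close> to the larger of its two prime factors, unless an element
  of \<open>M1\<close> occupies that slot. In that case \<open>cyc3_coincidence\<close> shows that no other element of
  \<open>E \<union> M1\<close> can claim the smaller factor.
\<close>

definition "slot s = (if s \<in> D1 then core s else if hi s \<in> core ` M1 then lo s else hi s)"

lemma prod_mset_M: "prod_mset (M s) = core s"
  using core_nonzero by (simp add: prod_mset_prime_factorization)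

lemma E_D:
  assumes "s \<in> E"
  shows "hi s \<in> V" "lo s \<in> V" "lo s < hi s" "cyc3 s = hi s * lo s" "s < hi s"
    "hi s \<in># M s" "lo s \<in># M s"
proof -
  have s: "s \<in> D2" "size (M s) = 2" using assms by (auto simp: E_def)
  then obtain a b where ab: "M s = {#a, b#}"
    by (blast elim: size_2_multisetE)
  then have c: "cyc3 s = a * b" using prod_mset_M[of s] D2_D s(1) by simp
  \<comment> \<open>Equal factors would place the square b^2 strictly between s^2 and (s +
    1)^2.\<close>
  have "a \<noteq> b"
  proof
    assume "a = b"
    then have "s^2 < b^2" "b^2 < (s + 1)^2"
      using c D2_D[OF s(1)] prime_gt_0_nat[of s] by (simp_all add: cyc3_def power2_eq_square)
    then have "s < b" "b < s + 1" by (auto dest: power_less_imp_less_base)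
    then show False by simp
  qed
  then have *: "lo s < hi s" "hi s * lo s = a * b" "hi s \<in># M s" "lo s \<in># M s"
    unfolding hi_def lo_def ab by (auto simp: max_def min_def)
  then show "lo s < hi s" "cyc3 s = hi s * lo s" "hi s \<in># M s" "lo s \<in># M s" using c by simp_all
  show "hi s \<in> V" "lo s \<in> V" using * prime_factor_core s(1) by auto
  show "s < hi s"
    using *(1) \<open>cyc3 s = hi s * lo s\<close>
    by (intro less_of_cyc3_less_square) (simp add: power2_eq_square)
qed

lemma V_D: "r \<in> V \<Longrightarrow> prime r \<and> odd r \<and> r mod 3 = 1 \<and> r \<ge> 3"
proof -
  assume "r \<in> V"
  then have "prime r" "odd r" "r mod 3 = 1" using odd_prime_factor by (auto simp: V_def)
  moreover have "r \<ge> 3" using prime_ge_2_nat[OF \<open>prime r\<close>] \<open>r mod 3 = 1\<close> by (cases "r = 2") auto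
  ultimately show ?thesis by simp
qed

lemma less_of_cyc3_eq_3_mult: "cyc3 x = 3 * r \<Longrightarrow> r \<ge> 3 \<Longrightarrow> x < r"
  by (rule less_of_cyc3_less_square) (simp add: power2_eq_square)

lemma M1_D:
  assumes "p \<in> M1"
  shows "p \<in> D1" "core p \<in> V" "cyc3 p = 3 * core p" "core p \<in># M p"
proof -
  show p: "p \<in> D1" using assms by (auto simp: M1_def)
  obtain a where a: "M p = {#a#}" using assms size_1_singleton_mset by (auto simp: M1_def)
  then have "core p = a" using prod_mset_M[of p] by simp
  then show "core p \<in># M p" using a by simp
  then show "core p \<in> V" using prime_factor_core p by blast
  show "cyc3 p = 3 * core p" using D1_D p by blast
qed

lemma A_D: "r \<in> A \<Longrightarrow> \<exists>t\<in>D2. prime (cyc3 t) \<and> r = cyc3 t \<and> t < r"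
  by (auto simp: A_def) (auto simp: cyc3_def)

lemma D2_root_unique:
  assumes "r \<in> V" "s \<in> D2" "t \<in> D2" "r dvd cyc3 s" "r dvd cyc3 t" "s < r" "t < r"
  shows "s = t"
  using assms V_D D2_D by (intro cyc3_root_unique[of r s t]) auto

text \<open>If \<open>hi s = cyc3 t\<close> with \<open>t\<close> in \<open>D2\<close>, then
  \<open>s\<close> and \<open>t\<close> are both roots below \<open>hi s\<close> that are 2 mod 3.
  Hence s = t and \<open>lo s\<close> would be 1.\<close>

lemma hi_notin_A:
  assumes "s \<in> E"
  shows "hi s \<notin> A"
proof
  assume "hi s \<in> A"
  then obtain t where t: "t \<in> D2" "hi s = cyc3 t" "t < hi s" using A_D by metis
  have "s = t" using E_D[OF assms] t assms
    by (intro D2_root_unique[of "hi s"]) (auto simp: E_def)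
  then have "hi s * lo s = hi s * 1" using E_D[OF assms] t by simp
  then show False using E_D[OF assms] V_D by (metis mult_cancel_left not_prime_0 not_prime_1)
qed

lemma third_notin_A:
  assumes "cyc3 x = 3 * r" "x mod 3 = 1"
  shows "r \<notin> A"
  using A_D cyc3_neq_3_mult_cyc3 D2_D assms by metis

text \<open>The smaller factor is now tied to the root \<open>p - 3\<close>. This root is even, so
  parity separates it from the odd elements of \<open>D1\<close> and \<open>D2\<close>.\<close>

lemma relocated:
  assumes "s \<in> E" "p \<in> M1" "core p = hi s"
  shows "cyc3 (p - 3) = 3 * lo s" "even (p - 3)" "(p - 3) mod 3 = 1" "p - 3 < lo s" "3 \<le> p"
proof -
  have p: "odd p" "p mod 3 = 1" "cyc3 p = 3 * hi s" using D1_D M1_D[OF assms(2)] assms(3) by auto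
  have s: "s mod 3 = 2" using D2_D assms(1) by (auto simp: E_def)
  note * = cyc3_coincidence[of "hi s" p s "lo s"]
  show p3: "3 \<le> p" and c: "cyc3 (p - 3) = 3 * lo s" using * p s E_D[OF assms(1)] V_D by auto
  show "even (p - 3)" using p by simp
  show "(p - 3) mod 3 = 1" using p p3 by (simp add: le_mod_geq)
  show "p - 3 < lo s" using c V_D E_D(2)[OF assms(1)] by (intro less_of_cyc3_eq_3_mult) auto
qed

lemma slot_in_B:
  assumes "s \<in> E \<union> M1"
  shows "slot s \<in> B"
proof (cases "s \<in> M1")
  case True
  then have "slot s = core s" "core s \<in> V" "core s \<notin> A"
    using M1_D[OF True] D1_D third_notin_A[of s "core s"] by (auto simp: slot_def)
  then show ?thesis by (simp add: B_def)
next
  case False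
  then have s: "s \<in> E" using assms by blast
  then have "s \<notin> D1" using D_disjoint by (auto simp: E_def)
  show ?thesis
  proof (cases "hi s \<in> core ` M1")
    case True
    then obtain p where "p \<in> M1" "core p = hi s" by force
    then have "lo s \<notin> A" using relocated[OF s] third_notin_A by blast
    then show ?thesis using True \<open>s \<notin> D1\<close> E_D(2)[OF s] by (simp add: slot_def B_def)
  next
    case False
    then show ?thesis using \<open>s \<notin> D1\<close> E_D(1)[OF s] hi_notin_A[OF s] by (simp add: slot_def B_def)
  qed
qed

section \<open>Injectivity of the slots\<close>

lemma core_M1_inj: "p \<in> M1 \<Longrightarrow> q \<in> M1 \<Longrightarrow> core p = core q \<Longrightarrow> p = q"
  using M1_D(3) by (metis cyc3_eq_iff)

lemma hi_inj: "s \<in> E \<Longrightarrow> t \<in> E \<Longrightarrow> hi s = hi t \<Longrightarrow> s = t"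
  using E_D[of s] E_D[of t] by (intro D2_root_unique[of "hi s"]) (auto simp: E_def)

text \<open>Equality would give \<open>q = p - 3\<close>, which is even.\<close>

lemma lo_neq_core:
  assumes "s \<in> E" "p \<in> M1" "core p = hi s" "q \<in> M1"
  shows "lo s \<noteq> core q"
proof
  assume "lo s = core q"
  then have "cyc3 (p - 3) = cyc3 q" using relocated(1)[OF assms(1-3)] M1_D(3)[OF assms(4)] by simp
  then have "q = p - 3" by simp
  then show False using relocated(2)[OF assms(1-3)] D1_D M1_D(1)[OF assms(4)] by blast
qed

text \<open>Modulo \<open>hi t\<close> the roots \<open>p - 3\<close> and \<open>t\<close> have
  opposite parity, so they are distinct, and their sum plus 1 is even, unlike
  \<open>hi t\<close>.\<close>

lemma lo_neq_hi:
  assumes "s \<in> E" "p \<in> M1" "core p = hi s" "t \<in> E"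
  shows "lo s \<noteq> hi t"
proof
  assume eq: "lo s = hi t"
  have t: "odd t" using assms(4) D2_D by (auto simp: E_def)
  have "p - 3 = t \<or> (p - 3) + t + 1 = hi t"
    using relocated[OF assms(1-3)] E_D[OF assms(4)] V_D eq
    by (intro cyc3_roots) auto
  moreover have "even (p - 3)" "odd (hi t)"
    using relocated(2)[OF assms(1-3)] V_D E_D(1)[OF assms(4)] by blast+
  ultimately show False using t by (metis even_add odd_one)
qed

text \<open>The factor \<open>lo s\<close> determines \<open>p - 3\<close>, hence \<open>p\<close>
  (as \<open>3 \<le> p\<close>), hence \<open>hi s\<close>.\<close>

lemma lo_inj:
  assumes "s \<in> E" "p \<in> M1" "core p = hi s" "t \<in> E" "q \<in> M1" "core q = hi t" "lo s = lo t"
  shows "s = t"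
proof -
  note r = relocated[OF assms(1-3)] relocated[OF assms(4-6)]
  have "cyc3 (p - 3) = cyc3 (q - 3)" using r assms(7) by simp
  then have "p = q" using r(5,10) by simp
  then show ?thesis using hi_inj assms by simp
qed

lemma inj_on_slot: "inj_on slot (E \<union> M1)"
proof -
  have M1: "slot p = core p" if "p \<in> M1" for p
    using that M1_D(1) by (simp add: slot_def)
  have E: "slot s = (if hi s \<in> core ` M1 then lo s else hi s)" if "s \<in> E" for s
    using that D_disjoint by (auto simp: slot_def E_def)
  have ME: "slot p \<noteq> slot s" if "p \<in> M1" "s \<in> E" for p s
  proof (cases "hi s \<in> core ` M1")
    case True
    then show ?thesis using that M1 E lo_neq_core by (metis imageE)
  next
    case False
    then have "core p \<noteq> hi s" using that(1) by (metis imageI)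
    then show ?thesis using that M1 E False by simp
  qed
  have EE: "s = t" if "s \<in> E" "t \<in> E" "slot s = slot t" for s t
  proof (cases "hi s \<in> core ` M1"; cases "hi t \<in> core ` M1")
    assume "hi s \<in> core ` M1" "hi t \<in> core ` M1"
    then show ?thesis using that E lo_inj by (metis imageE)
  next
    assume "hi s \<in> core ` M1" "hi t \<notin> core ` M1"
    then show ?thesis using that E lo_neq_hi by (metis imageE)
  next
    assume "hi s \<notin> core ` M1" "hi t \<in> core ` M1"
    then show ?thesis using that E lo_neq_hi by (metis imageE)
  next
    assume "hi s \<notin> core ` M1" "hi t \<notin> core ` M1"
    then show ?thesis using that E hi_inj by simp
  qed
  show ?thesis
  proof (rule inj_onI)
    fix x y assume "x \<in> E \<union> M1" "y \<in> E \<union> M1" "slot x = slot y"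
    then show "x = y" using ME EE M1 core_M1_inj by (metis UnE)
  qed
qed

lemma card_slots: "card (E \<union> M1) \<le> card B"
  using inj_on_slot slot_in_B by (intro card_inj_on_le) auto

section \<open>Lower bounds for the weights\<close>

lemma sum_weight_ge: "5 * size K \<le> (\<Sum>r\<in>#K. weight r)"
proof -
  have "(\<Sum>r\<in>#K. 5) \<le> (\<Sum>r\<in>#K. weight r)"
    by (rule sum_mset_mono) (simp add: weight_def)
  then show ?thesis by (simp add: mult.commute)
qed

lemma W_ge: "5 * size (M s) \<le> W s"
  unfolding W_def by (rule sum_weight_ge)

lemma W_ge_if_notin_A:
  assumes "r \<in># M s" "r \<notin> A"
  shows "5 * size (M s) + 2 \<le> W s"
proof -
  obtain K where K: "M s = add_mset r K" using assms(1) by (metis insert_DiffM)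
  then show ?thesis using sum_weight_ge[of K] assms(2) by (simp add: W_def weight_def[of r])
qed

lemma core_neq_1: "s \<in> D1 \<union> D2 \<Longrightarrow> core s \<noteq> 1"
proof
  assume s: "s \<in> D1 \<union> D2" and 1: "core s = 1"
  then have "cyc3 s \<le> cyc3 1" using D1_D[of s] D2_D[of s] by (auto simp: cyc3_def[of "Suc 0"])
  then have "s \<le> 1" using strict_mono_cyc3 by (simp add: strict_mono_less_eq)
  then show False using s D1_D[of s] D2_D[of s] by (auto dest: prime_ge_2_nat)
qed

lemma size_M_pos: "s \<in> D1 \<union> D2 \<Longrightarrow> size (M s) \<noteq> 0"
  using core_neq_1 core_nonzero by (auto simp: prime_factorization_empty_iff)

text \<open>With two factors the larger one is outside \<open>A\<close> and the bonus applies. Three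
  factors cannot all lie in \<open>A\<close>, by \<open>cyc3_neq_triple_product\<close>. Four
  factors already weigh 20.\<close>

lemma W_D2:
  assumes "s \<in> D2" "\<not> prime (cyc3 s)"
  shows "17 \<le> W s + (if s \<in> E then 5 else 0)"
proof -
  have "size (M s) \<noteq> 1"
  proof
    assume "size (M s) = 1"
    then obtain a where a: "M s = {#a#}" using size_1_singleton_mset by blast
    then have "a \<in># M s" by simp
    then have "prime a" by auto
    then show False using a prod_mset_M[of s] D2_D assms by simp
  qed
  moreover have "size (M s) \<noteq> 0" using size_M_pos[of s] assms(1) by simp
  ultimately consider "size (M s) = 2" | "size (M s) = 3" | "size (M s) \<ge> 4" by linarith
  then show ?thesis
  proof cases
    case 1
    then have "s \<in> E" using assms(1) by (simp add: E_def)
    then show ?thesis using W_ge_if_notin_A[of "hi s" s] E_D hi_notin_A 1 by simp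
  next
    case 2
    then obtain a b c where abc: "M s = {#a, b, c#}"
      by (blast elim: size_3_multisetE)
    have c: "cyc3 s = a * (b * c)" using prod_mset_M[of s] D2_D assms(1) abc by (simp add: mult_ac)
    have "\<exists>r \<in># M s. r \<notin> A"
    proof (rule ccontr)
      assume "\<not> ?thesis"
      then have "a \<in> A" "b \<in> A" "c \<in> A" by (auto simp: abc)
      then obtain x y z where "x \<in> D2" "prime (cyc3 x)" "a = cyc3 x"
        and "y \<in> D2" "prime (cyc3 y)" "b = cyc3 y" and "z \<in> D2" "prime (cyc3 z)" "c = cyc3 z"
        using A_D[of a] A_D[of b] A_D[of c] by blast
      then show False
        using cyc3_neq_triple_product[of x y z s] D2_D[of x] D2_D[of y] D2_D[of z] c by simp
    qed
    then show ?thesis using W_ge_if_notin_A 2 by fastforce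
  next
    case 3
    then show ?thesis using W_ge[of s] by simp
  qed
qed

lemma W_single: "s \<in> D2 \<Longrightarrow> 5 \<le> W s"
  using W_ge[of s] size_M_pos[of s] by (cases "size (M s)") auto

text \<open>A single factor is outside \<open>A\<close> and gets the bonus; two factors cannot both
  lie in \<open>A\<close>, by \<open>cyc3_neq_3_mult_cyc3_mult_cyc3\<close>; three already weigh
  15.\<close>

lemma W_D1:
  assumes "p \<in> D1"
  shows "12 \<le> W p + (if p \<in> M1 then 5 else 0)"
proof -
  have "size (M p) \<noteq> 0" using size_M_pos[of p] assms by simp
  then consider "size (M p) = 1" | "size (M p) = 2" | "size (M p) \<ge> 3" by linarith
  then show ?thesis
  proof cases
    case 1
    then have p: "p \<in> M1" using assms(1) by (simp add: M1_def)
    have "core p \<notin> A" using third_notin_A M1_D(3)[OF p] D1_D assms by blast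
    then show ?thesis using W_ge_if_notin_A[of "core p" p] M1_D(4)[OF p] p 1 by simp
  next
    case 2
    then obtain a b where ab: "M p = {#a, b#}"
      by (blast elim: size_2_multisetE)
    have c: "cyc3 p = 3 * (a * b)" using prod_mset_M[of p] D1_D assms(1) ab by simp
    have "\<exists>r \<in># M p. r \<notin> A"
    proof (rule ccontr)
      assume "\<not> ?thesis"
      then have "a \<in> A" "b \<in> A" by (auto simp: ab)
      then obtain x y where "x \<in> D2" "prime (cyc3 x)" "a = cyc3 x"
        and "y \<in> D2" "prime (cyc3 y)" "b = cyc3 y"
        using A_D[of a] A_D[of b] by blast
      then show False
        using cyc3_neq_3_mult_cyc3_mult_cyc3[of p x y] D1_D[of p] D2_D[of x] D2_D[of y] c assms by simp
    qed
    then show ?thesis using W_ge_if_notin_A 2 by fastforce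
  next
    case 3
    then show ?thesis using W_ge[of p] by simp
  qed
qed

lemma card_A: "card A = card {s \<in> D2. prime (cyc3 s)}"
  unfolding A_def by (rule card_image) (auto intro: inj_onI)

text \<open>The weights plus bonuses are summed over \<open>D1 \<union> D2\<close>. The lower
  estimates are 5 for prime values, 17 for the rest of \<open>D2\<close> and 12 for
  \<open>D1\<close>; from above, the bonuses cost at most 5 per element of \<open>B\<close>.\<close>

lemma weight_inequality:
  "5 * card A + 17 * (card D2 - card A) + 12 * card D1
    \<le> 5 * (\<Sum>r\<in>A. e r) + 7 * (\<Sum>r\<in>B. e r) + 5 * card B"
proof -
  let ?S = "{s \<in> D2. prime (cyc3 s)}" and ?w = "\<lambda>s. W s + (if s \<in> E \<union> M1 then 5 else 0)"
  have D2: "D2 = ?S \<union> (D2 - ?S)" by auto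
  have bound: "card X * c \<le> (\<Sum>s\<in>X. ?w s)" if "\<And>s. s \<in> X \<Longrightarrow> c \<le> ?w s" for X c
    using sum_bounded_below[of X c ?w] that by simp
  have "card A * 5 \<le> (\<Sum>s\<in>?S. ?w s)"
    unfolding card_A by (rule bound) (simp add: W_single)
  moreover have "card (D2 - ?S) * 17 \<le> (\<Sum>s\<in>D2 - ?S. ?w s)"
  proof (rule bound)
    fix s assume "s \<in> D2 - ?S"
    then show "17 \<le> ?w s" using W_D2[of s] by (cases "s \<in> E") auto
  qed
  moreover have "card D1 * 12 \<le> (\<Sum>s\<in>D1. ?w s)"
  proof (rule bound)
    fix p assume "p \<in> D1"
    then show "12 \<le> ?w p" using W_D1[of p] by (cases "p \<in> M1") auto
  qed
  moreover have "card (D2 - ?S) = card D2 - card A"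
    unfolding card_A by (intro card_Diff_subset) auto
  moreover have "(\<Sum>s\<in>D2. ?w s) = (\<Sum>s\<in>?S. ?w s) + (\<Sum>s\<in>D2 - ?S. ?w s)"
    by (subst D2, rule sum.union_disjoint) auto
  moreover have "(\<Sum>s\<in>D1 \<union> D2. ?w s) = (\<Sum>s\<in>D1. ?w s) + (\<Sum>s\<in>D2. ?w s)"
    using D_disjoint by (intro sum.union_disjoint) auto
  moreover have "(\<Sum>s\<in>D1 \<union> D2. ?w s) = (\<Sum>s\<in>D1 \<union> D2. W s) + 5 * card (E \<union> M1)"
  proof -
    have "(D1 \<union> D2) \<inter> (E \<union> M1) = E \<union> M1" by (auto simp: E_def M1_def)
    then have "(\<Sum>s\<in>D1 \<union> D2. if s \<in> E \<union> M1 then 5 else 0) = (\<Sum>s\<in>E \<union> M1. 5::nat)"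
      by (simp only: sum.inter_restrict[symmetric] finite_UnI finite_sets)
    then have "(\<Sum>s\<in>D1 \<union> D2. if s \<in> E \<union> M1 then 5 else 0) = 5 * card (E \<union> M1)"
      by simp
    then show ?thesis by (simp only: sum.distrib)
  qed
  ultimately show ?thesis using sum_W_le card_slots by linarith
qed

section \<open>Counting prime factors\<close>

definition "odd_in X = card {p \<in> X. odd (e p)}"

text \<open>An exponent 2 falls short of 4 by 2, and an odd exponent, possibly 1, by at most
  3.\<close>

lemma sum_exponents_ge:
  assumes "X \<subseteq> P"
  shows "4 * card X \<le> (\<Sum>p\<in>X. e p) + 2 * card {p \<in> X. e p = 2} + 3 * odd_in X"
proof -
  have fin: "finite X" using assms finite_subset by blast
  have "4 * card X = (\<Sum>p\<in>X. 4)" by simp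
  also have "\<dots> \<le> (\<Sum>p\<in>X. e p + (if e p = 2 then 2 else 0) + (if odd (e p) then 3 else 0))"
  proof (rule sum_mono)
    fix p assume "p \<in> X"
    then show "4 \<le> e p + (if e p = 2 then 2 else 0) + (if odd (e p) then 3 else 0)"
      using exponent_cases[of p] assms by (cases "odd (e p)") (auto elim: oddE)
  qed
  also have "\<dots> = (\<Sum>p\<in>X. e p) + 2 * card {p \<in> X. e p = 2} + 3 * odd_in X"
    using fin by (simp add: sum.distrib sum.inter_filter[symmetric] odd_in_def)
  finally show ?thesis .
qed

definition "O2 = {p \<in> P. p mod 3 = 2 \<and> e p \<noteq> 2}"

text \<open>A set that is empty or \<open>{3}\<close>, so that one partition of \<open>P\<close>
  serves both cases.\<close>

definition "P3 = {p \<in> P. p = 3}"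

lemma P_partition: "P = D2 \<union> (A \<union> (B \<union> (O2 \<union> P3)))"
proof -
  have "p \<in> D2 \<union> (V \<union> (O2 \<union> P3))" if "p \<in> P" for p
  proof -
    have "p mod 3 = 0 \<Longrightarrow> p = 3"
      using that primes_dvd_imp_eq[of 3 p] by (auto simp: dvd_eq_mod_eq_0)
    moreover have "p mod 3 < 3" by simp
    then have "p mod 3 = 0 \<or> p mod 3 = 1 \<or> p mod 3 = 2" by linarith
    ultimately show ?thesis using that by (auto simp: D2_def V_def O2_def P3_def)
  qed
  moreover have "V = A \<union> B" using A_subset_V by (auto simp: B_def)
  moreover have "D2 \<union> (V \<union> (O2 \<union> P3)) \<subseteq> P" by (auto simp: D2_def V_def O2_def P3_def)
  ultimately show ?thesis by blast
qed

lemma sum_P: "(\<Sum>p\<in>P. f p) = (\<Sum>p\<in>D2. f p) + ((\<Sum>p\<in>A. f p) + ((\<Sum>p\<in>B. f p)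
    + ((\<Sum>p\<in>O2. f p) + (\<Sum>p\<in>P3. f p))))" for f :: "nat \<Rightarrow> nat"
proof -
  have [simp]: "finite O2" "finite P3" by (auto simp: O2_def P3_def)
  have "A \<subseteq> V" "B \<subseteq> V" "A \<inter> B = {}" using A_subset_V by (auto simp: B_def)
  then have "D2 \<inter> (A \<union> (B \<union> (O2 \<union> P3))) = {}" "A \<inter> (B \<union> (O2 \<union> P3)) = {}"
    "B \<inter> (O2 \<union> P3) = {}" "O2 \<inter> P3 = {}"
    by (auto simp: V_def D2_def O2_def P3_def)
  then show ?thesis unfolding P_partition by (simp add: sum.union_disjoint)
qed

lemma odd_in_total: "odd_in A + odd_in B + odd_in O2 \<le> 1"
proof -
  have "card {p \<in> P. odd (e p)} \<le> Suc 0"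
    by (subst card_le_Suc0_iff_eq) (auto intro: odd_exponent_unique)
  moreover have "card {p \<in> X. odd (e p)} = (\<Sum>p\<in>X. if odd (e p) then 1 else 0)"
    if "X \<subseteq> P" for X
    using finite_subset[OF that] by (simp add: sum.inter_filter[symmetric])
  moreover have "A \<subseteq> P" "B \<subseteq> P" "O2 \<subseteq> P" using P_partition by blast+
  ultimately show ?thesis
    using sum_P[of "\<lambda>p. if odd (e p) then 1 else 0"] unfolding odd_in_def by simp
qed

lemma exponent_2_plus_odd_le:
  assumes "X \<subseteq> P"
  shows "card {p \<in> X. e p = 2} + odd_in X \<le> card X"
proof -
  have fin: "finite X" using assms finite_subset by blast
  have "card {p \<in> X. e p = 2} + odd_in X = card ({p \<in> X. e p = 2} \<union> {p \<in> X. odd (e p)})"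
    unfolding odd_in_def using fin by (intro card_Un_disjoint[symmetric]) auto
  also have "\<dots> \<le> card X" using fin by (intro card_mono) auto
  finally show ?thesis .
qed

section \<open>The two linear combinations\<close>

lemma prime_count_bounds:
  "\<not> 3 dvd N \<Longrightarrow> 302 * card P \<le> 113 * size (prime_factorization N) + 286"
  "3 dvd N \<Longrightarrow> 66 * card P \<le> 25 * size (prime_factorization N) + 125"
proof -
  define a b x o' where "a = card A" and "b = card B" and "x = card D2 - card A" and "o' = card O2"
  define a1 b1 where "a1 = card {p \<in> A. e p = 2}" and "b1 = card {p \<in> B. e p = 2}"
  define EA EB EO E3 where "EA = (\<Sum>p\<in>A. e p)" and "EB = (\<Sum>p\<in>B. e p)"
    and "EO = (\<Sum>p\<in>O2. e p)" and "E3 = (\<Sum>p\<in>P3. e p)"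
  define oa ob oo where "oa = odd_in A" and "ob = odd_in B" and "oo = odd_in O2"
  have sub: "A \<subseteq> P" "B \<subseteq> P" "O2 \<subseteq> P" using P_partition by blast+
  have "card A \<le> card D2" unfolding card_A by (auto intro: card_mono)
  then have D2: "card D2 = x + a" by (simp add: a_def x_def)
  have "size (prime_factorization N) = (\<Sum>p\<in>P. e p)"
    unfolding size_multiset_overloaded_eq
    by (intro sum.cong refl count_prime_factorization_prime) auto
  moreover have "(\<Sum>p\<in>D2. e p) = 2 * card D2" by (simp add: D2_def)
  ultimately have Omega: "size (prime_factorization N) = 2 * x + 2 * a + EA + EB + EO + E3"
    using sum_P[of e] D2 by (simp add: EA_def EB_def EO_def E3_def)
  have omega: "card P = x + 2 * a + b + o' + card P3"
    using sum_P[of "\<lambda>_. 1"] D2 by (simp add: a_def b_def o'_def)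
  have "D1 = {p \<in> A. e p = 2} \<union> {p \<in> B. e p = 2}"
    using A_subset_V by (auto simp: B_def D1_def V_def)
  then have D1: "card D1 = a1 + b1"
    by (simp add: card_Un_disjoint B_def disjoint_iff a1_def b1_def)
  have key: "5 * a + 17 * x + 12 * (a1 + b1) \<le> 5 * EA + 7 * EB + 5 * b"
    using weight_inequality unfolding D1 by (simp add: a_def b_def x_def EA_def EB_def)
  have "card {p \<in> O2. e p = 2} = 0" by (auto simp: O2_def)
  then have EA: "4 * a \<le> EA + 2 * a1 + 3 * oa" "a1 + oa \<le> a"
    and EB: "4 * b \<le> EB + 2 * b1 + 3 * ob" "b1 + ob \<le> b"
    and EO: "4 * o' \<le> EO + 3 * oo" "oo \<le> o'"
    using sub[THEN sum_exponents_ge] sub[THEN exponent_2_plus_odd_le]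
    by (simp_all add: a_def b_def o'_def a1_def b1_def EA_def EB_def EO_def oa_def ob_def oo_def)
  have special: "oa + ob + oo \<le> 1" using odd_in_total by (simp add: oa_def ob_def oo_def)
  show "302 * card P \<le> 113 * size (prime_factorization N) + 286" if "\<not> 3 dvd N"
  proof -
    have "card P3 = 0" "card D1 = 0"
      using that card_D1_le by (auto simp: P3_def not_dvd_imp_multiplicity_0)
    then have 0: "card P3 = 0" "a1 = 0" "b1 = 0" using D1 by auto
    \<comment> \<open>The bound is proved doubled, with 9 times \<open>key\<close> as input. This
      leaves 226 - 45 = 181 for \<open>EA\<close>, 226 - 63 = 163 for \<open>EB\<close>, 756 - 45 =
      711 for \<open>a\<close> and 604 + 45 = 649 for \<open>b\<close>. The constant 530 = 711 - 181
      is the largest deficit a prime of exponent 1 can cause.\<close>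
    have "711 * a \<le> 181 * EA + 530 * oa" using EA 0 by linarith
    moreover have "649 * b \<le> 163 * EB + 530 * ob" using EB 0 by linarith
    moreover have "604 * o' \<le> 226 * EO + 530 * oo" using EO by linarith
    ultimately have "711 * a + 649 * b + 604 * o' \<le> 181 * EA + 163 * EB + 226 * EO + 572"
      using special by linarith
    moreover have "45 * a + 153 * x \<le> 45 * EA + 63 * EB + 45 * b" using key 0 by linarith
    ultimately have "604 * (x + 2 * a + b + o') \<le> 226 * (2 * x + 2 * a + EA + EB + EO + E3) + 572"
      by (simp add: algebra_simps)
    then show ?thesis unfolding Omega omega 0 by simp
  qed
  show "66 * card P \<le> 25 * size (prime_factorization N) + 125" if "3 dvd N"
  proof -
    have "P3 = {3}" using that N_pos by (auto simp: P3_def prime_factors_dvd)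
    then have 3: "card P3 = 1" "a1 + b1 \<le> E3" using card_D1_le D1 by (auto simp: E3_def)
    \<comment> \<open>Here \<open>key\<close> enters once, leaving 25 - 5 = 20, 25 - 7 = 18, 82 - 5
      = 77 and 66 + 5 = 71. In 37 = 12 + 25 the 12 comes from \<open>key\<close> and the 25 from the
      power of 3 forced by \<open>D1\<close>. The deficit at exponent 1 is at most 57 = 77 -
      20.\<close>
    have "77 * a \<le> 20 * EA + 37 * a1 + 57 * oa" using EA by linarith
    moreover have "71 * b \<le> 18 * EB + 37 * b1 + 57 * ob" using EB by linarith
    moreover have "66 * o' \<le> 25 * EO + 57 * oo" using EO by linarith
    moreover have "57 * oa + 57 * ob + 57 * oo \<le> 57" using special by linarith
    ultimately have "77 * a + 71 * b + 66 * o' \<le> 20 * EA + 18 * EB + 25 * EO + 37 * (a1 + b1) + 57"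
      by simp
    moreover have "25 * (a1 + b1) \<le> 25 * E3" using 3 by simp
    ultimately show ?thesis unfolding Omega omega 3(1) using key by (simp add: algebra_simps)
  qed
qed

end

theorem theorem2:
  fixes N :: nat
  assumes "odd N" and "perfect N"
  shows "(\<not> 3 dvd N \<longrightarrow>
            302 / 113 * real (primes_omega N) - 286 / 113 \<le> real (primes_Omega N)) \<and>
         (3 dvd N \<longrightarrow>
            66 / 25 * real (primes_omega N) - 5 \<le> real (primes_Omega N))"
proof -
  interpret odd_perfect N using assms by unfold_locales
  have "302 * real (primes_omega N) \<le> 113 * real (primes_Omega N) + 286" if "\<not> 3 dvd N"
    using prime_count_bounds(1)[OF that] unfolding primes_omega_def primes_Omega_def by linarith
  moreover have "66 * real (primes_omega N) \<le> 25 * real (primes_Omega N) + 125" if "3 dvd N"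
    using prime_count_bounds(2)[OF that] unfolding primes_omega_def primes_Omega_def by linarith
  ultimately show ?thesis by (auto simp: field_simps)
qed

end
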